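(* For every $c,n>1$, every pseudo-deterministic streaming algorithm for the problem $\mathsf{ApproxCount}_{c,n}$ must use $\Omega_c\big(\sqrt{\log n/\log\log n}\big)$ bits of space.
   Context: $\mathsf{ApproxCount}_{c,n}$ is the promise version of $c$-approximate counting: the input is a stream of length at most $(c+1)n$, and the algorithm must distinguish (output, say, $0$ or $1$ accordingly) whether the number of stream items is at most $n$ or greater than $cn$; a randomized algorithm must answer correctly with probability at least $9/10$ on every stream satisfying this promise. A streaming algorithm $A$ is pseudo-deterministic (PD) if there is a function $F$ defined on all input streams (including streams whose length lies in $[n+1,cn]$, outside the promise), called its canonical function, such that for every stream $\sigma$, $\Pr[A(\sigma)=F(\sigma)]\ge 9/10$, the probability being over the algorithm's random choices. Space is measured in bits of memory. The notation $\Omega_c(\cdot)$ hides factors polynomial in $c$. *)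

theory Defs
  imports "HOL-Probability.Probability"
begin

text \<open>
  A randomized one-pass streaming algorithm over items of type \<open>'a\<close> with answers of type \<open>'b\<close>.
  The memory content between two items is a bit string; every item is processed with fresh coins,
  so anything retained (including old coins or a clock) has to be stored in the memory.
  No bounds are imposed on the computation, which makes lower bounds stronger.
\<close>

record ('a, 'b) streaming_alg =
  initial :: "bool list pmf"
  process :: "'a \<Rightarrow> bool list \<Rightarrow> bool list pmf"
  answer  :: "bool list \<Rightarrow> 'b pmf"

definition memory_after :: "('a, 'b) streaming_alg \<Rightarrow> 'a list \<Rightarrow> bool list pmf" where
  "memory_after A \<sigma> = fold (\<lambda>x p. bind_pmf p (process A x)) \<sigma> (initial A)"

definition run_alg :: "('a, 'b) streaming_alg \<Rightarrow> 'a list \<Rightarrow> 'b pmf" where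
  "run_alg A \<sigma> = bind_pmf (memory_after A \<sigma>) (answer A)"

text \<open>
  Worst-case space over a set \<open>I\<close> of input streams. The sets used below are closed under prefixes,
  so bounding the memory at the end of each stream bounds it throughout.
\<close>

definition uses_space :: "'a list set \<Rightarrow> ('a, 'b) streaming_alg \<Rightarrow> nat \<Rightarrow> bool" where
  "uses_space I A s \<longleftrightarrow> (\<forall>\<sigma>\<in>I. \<forall>m\<in>set_pmf (memory_after A \<sigma>). length m \<le> s)"

definition canonical_function ::
    "'a list set \<Rightarrow> ('a, 'b) streaming_alg \<Rightarrow> ('a list \<Rightarrow> 'b) \<Rightarrow> bool" where
  "canonical_function I A F \<longleftrightarrow> (\<forall>\<sigma>\<in>I. pmf (run_alg A \<sigma>) (F \<sigma>) \<ge> 9/10)"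

definition pseudo_deterministic :: "'a list set \<Rightarrow> ('a, 'b) streaming_alg \<Rightarrow> bool" where
  "pseudo_deterministic I A \<longleftrightarrow> (\<exists>F. canonical_function I A F)"

definition count_streams :: "'a set \<Rightarrow> real \<Rightarrow> nat \<Rightarrow> 'a list set" where
  "count_streams U c n = {\<sigma> \<in> lists U. real (length \<sigma>) \<le> (c + 1) * real n}"

text \<open>The answer \<open>False\<close> stands for ``at most \<open>n\<close> items'', \<open>True\<close> for ``more than \<open>cn\<close> items''.\<close>

definition solves_approx_count ::
    "'a set \<Rightarrow> real \<Rightarrow> nat \<Rightarrow> ('a, bool) streaming_alg \<Rightarrow> bool" where
  "solves_approx_count U c n A \<longleftrightarrow>
     (\<forall>\<sigma>\<in>count_streams U c n.
        (length \<sigma> \<le> n \<longrightarrow> pmf (run_alg A \<sigma>) False \<ge> 9/10) \<and>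
        (real (length \<sigma>) > c * real n \<longrightarrow> pmf (run_alg A \<sigma>) True \<ge> 9/10))"

end

theory Submission
  imports Defs
begin

text \<open>
  Feeding one fixed item turns the algorithm into a Markov chain on at most \<open>2^(s+1)\<close> states and its
  canonical function into a 0/1 string \<open>F\<close> that begins with \<open>n\<close> zeros and ends with \<open>n\<close> ones. From the
  state at time \<open>t\<close> one can predict \<open>F (t + i)\<close> for each \<open>i\<close>, so the state must identify the shift \<open>t\<close>.

  Every set \<open>T\<close> of at least two shifts has a query \<open>i\<close> for which both values of \<open>F (t + i)\<close> occur on an
  \<open>\<Omega>(1/ln n)\<close> fraction of \<open>T\<close>. Otherwise let \<open>X\<^sub>j\<close> be the sum of \<open>j\<close> independent uniform elements of \<open>T\<close>.
  Changing one summand at a time shows that \<open>F (y + X\<^sub>j)\<close> is almost constant for all \<open>j\<close> up to a large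
  multiple of \<open>ln n\<close>. The entropy of \<open>X\<^sub>j\<close> never exceeds \<open>ln n\<close>, so one of its increments is small, which
  means that \<open>X\<^sub>j + t\<close> and \<open>X\<^sub>j + t'\<close> have nearly the same law for two distinct \<open>t, t' \<in> T\<close>. Hence the
  majority value of \<open>F (y + X\<^sub>j)\<close> is periodic in \<open>y\<close>, although it is 0 at the beginning and 1 at the end.

  Iterating balanced queries gives a complete binary query tree of depth \<open>D = \<Omega>(ln n / ln ln n)\<close>. The
  state at time \<open>t\<close> predicts at least 9/10 of the answers on the branch to \<open>t\<close> on average, while a fixed
  state predicts about half of the answers on a random branch. Comparing exponential moments, there
  must be exponentially many states in \<open>D\<close>.
\<close>

section \<open>Entropy and relative entropy of finitely supported distributions\<close>

text \<open>Relative entropy in nats, for finite supports with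
  \<open>set_pmf p \<subseteq> set_pmf q\<close>; otherwise the logarithm at 0 is only a default
  value.\<close>

definition kl :: "'a pmf \<Rightarrow> 'a pmf \<Rightarrow> real" where
  "kl p q = measure_pmf.expectation p (\<lambda>z. ln (pmf p z) - ln (pmf q z))"

definition ent :: "'a pmf \<Rightarrow> real" where
  "ent p = - measure_pmf.expectation p (\<lambda>z. ln (pmf p z))"

lemma expectation_pmf_sum:
  fixes f :: "'a \<Rightarrow> real"
  assumes "finite A" "set_pmf p \<subseteq> A"
  shows "measure_pmf.expectation p f = (\<Sum>z\<in>A. pmf p z * f z)"
  by (subst integral_measure_pmf_real[of A]) (use assms in \<open>auto simp: mult.commute\<close>)

text \<open>Pointwise, \<open>ln y \<le> y - 1\<close> at \<open>y = q r / p\<close>. This is the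
  Donsker-Varadhan bound with the logarithm of the \<open>q\<close>-mean of \<open>r\<close>
  linearized.\<close>

lemma kl_ge_variational:
  fixes p q :: "'a pmf" and r :: "'a \<Rightarrow> real"
  assumes fin: "finite (set_pmf q)" and sub: "set_pmf p \<subseteq> set_pmf q" and r: "\<And>z. r z > 0"
  shows "measure_pmf.expectation p (\<lambda>z. ln (r z)) + 1 - measure_pmf.expectation q r \<le> kl p q"
proof -
  let ?A = "set_pmf q"
  have pt: "pmf p z * ln (r z) + pmf p z - pmf q z * r z \<le> pmf p z * (ln (pmf p z) - ln (pmf q z))"
    if "z \<in> ?A" for z
  proof (cases "pmf p z = 0")
    case True
    then show ?thesis using r[of z] by simp
  next
    case False
    then have p: "pmf p z > 0" by (simp add: pmf_nonneg order_less_le)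
    have q: "pmf q z > 0" using that by (simp add: pmf_positive)
    have "ln (pmf q z * r z / pmf p z) \<le> pmf q z * r z / pmf p z - 1"
      using p q r by (intro ln_le_minus_one) auto
    moreover have "ln (pmf q z * r z / pmf p z) = ln (pmf q z) + ln (r z) - ln (pmf p z)"
      using p q r[of z] by (simp add: ln_div ln_mult)
    ultimately have "ln (r z) + 1 - pmf q z * r z / pmf p z \<le> ln (pmf p z) - ln (pmf q z)" by linarith
    then have "pmf p z * (ln (r z) + 1 - pmf q z * r z / pmf p z) \<le> pmf p z * (ln (pmf p z) - ln (pmf q z))"
      using p by (intro mult_left_mono) auto
    then show ?thesis using p by (simp add: algebra_simps)
  qed
  have "(\<Sum>z\<in>?A. pmf p z) = 1" using fin sub by (intro sum_pmf_eq_1)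
  then have "measure_pmf.expectation p (\<lambda>z. ln (r z)) + 1 - measure_pmf.expectation q r
     = (\<Sum>z\<in>?A. pmf p z * ln (r z) + pmf p z - pmf q z * r z)"
    using fin sub by (simp add: expectation_pmf_sum[of ?A] sum.distrib sum_subtractf)
  also have "\<dots> \<le> (\<Sum>z\<in>?A. pmf p z * (ln (pmf p z) - ln (pmf q z)))"
    by (intro sum_mono pt)
  also have "\<dots> = kl p q" unfolding kl_def
    using fin sub by (simp add: expectation_pmf_sum[of ?A])
  finally show ?thesis .
qed

lemma kl_nonneg:
  assumes "finite (set_pmf q)" "set_pmf p \<subseteq> set_pmf q"
  shows "kl p q \<ge> 0"
  using kl_ge_variational[OF assms, of "\<lambda>_. 1"] by simp

lemma kl_ge_of_test:
  fixes f :: "'a \<Rightarrow> real"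
  assumes fin: "finite (set_pmf q)" and sub: "set_pmf p \<subseteq> set_pmf q"
    and f01: "\<And>z. f z = 0 \<or> f z = 1"
    and p: "measure_pmf.expectation p f \<le> 1/10" and q: "measure_pmf.expectation q f \<ge> 1/2"
  shows "kl p q \<ge> 1/5"
proof -
  have fp: "finite (set_pmf p)" using fin sub finite_subset by blast
  have i: "integrable (measure_pmf p) g" "integrable (measure_pmf q) g" for g :: "'a \<Rightarrow> real"
    using fp fin by (auto intro: integrable_measure_pmf_finite)
  \<comment> \<open>The variational bound is tested with the values 3/2 and 1/2: the
    \<open>q\<close>-mean is then at most 1, and the \<open>p\<close>-mean of the logarithm is at
    least 1/3 - 4/30 = 1/5.\<close>
  let ?r = "\<lambda>z. 3/2 - f z"
  have r: "?r z > 0" for z using f01[of z] by auto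
  have l: "1/3 - 4/3 * f z \<le> ln (?r z)" for z
  proof -
    have "- ln (?r z) \<le> inverse (?r z) - 1"
      using ln_le_minus_one[of "inverse (?r z)"] r[of z] by (simp add: ln_inverse)
    then show ?thesis using f01[of z] by auto
  qed
  have "1/3 - 4/3 * measure_pmf.expectation p f = measure_pmf.expectation p (\<lambda>z. 1/3 - 4/3 * f z)"
    by (simp add: i)
  also have "\<dots> \<le> measure_pmf.expectation p (\<lambda>z. ln (?r z))"
    by (intro integral_mono i l)
  finally have "1/3 - 4/30 \<le> measure_pmf.expectation p (\<lambda>z. ln (?r z))" using p by linarith
  moreover have "measure_pmf.expectation q ?r = 3/2 - measure_pmf.expectation q f"
    by (simp add: i)
  ultimately show ?thesis using kl_ge_variational[OF fin sub, of ?r] r q by force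
qed

lemma kl_ge_of_test_compl:
  fixes f :: "'a \<Rightarrow> real"
  assumes fin: "finite (set_pmf q)" and sub: "set_pmf p \<subseteq> set_pmf q"
    and f01: "\<And>z. f z = 0 \<or> f z = 1"
    and p: "measure_pmf.expectation p f \<ge> 9/10" and q: "measure_pmf.expectation q f \<le> 1/2"
  shows "kl p q \<ge> 1/5"
proof -
  have fp: "finite (set_pmf p)" using fin sub finite_subset by blast
  have i: "integrable (measure_pmf p) f" "integrable (measure_pmf q) f"
    using fp fin by (auto intro: integrable_measure_pmf_finite)
  show ?thesis
    by (rule kl_ge_of_test[OF fin sub, of "\<lambda>z. 1 - f z"]) (use f01 p q i in auto)
qed

text \<open>Gibbs' inequality against the constant weight \<open>1/n\<close>, again from
  \<open>ln y \<le> y - 1\<close>.\<close>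

lemma ent_le_ln_card:
  assumes "finite A" "set_pmf p \<subseteq> A" "card A \<le> n"
  shows "ent p \<le> ln (real n)"
proof -
  let ?S = "set_pmf p"
  have fin: "finite ?S" using assms finite_subset by blast
  have cS: "card ?S \<le> n" using assms card_mono le_trans by blast
  have "card ?S > 0" using fin set_pmf_not_empty by (simp add: card_gt_0_iff)
  then have n: "n > 0" using cS by simp
  have pt: "- pmf p z * ln n + pmf p z - 1/n \<le> pmf p z * ln (pmf p z)" if "z \<in> ?S" for z
  proof -
    have p: "pmf p z > 0" using that by (simp add: pmf_positive)
    have "ln (1 / (n * pmf p z)) \<le> 1 / (n * pmf p z) - 1"
      using p n by (intro ln_le_minus_one) auto
    moreover have "ln (1 / (n * pmf p z)) = - ln n - ln (pmf p z)"
      using p n by (simp add: ln_div ln_mult)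
    ultimately have "- ln n + 1 - 1 / (n * pmf p z) \<le> ln (pmf p z)" by linarith
    then have "pmf p z * (- ln n + 1 - 1 / (n * pmf p z)) \<le> pmf p z * ln (pmf p z)"
      using p by (intro mult_left_mono) auto
    then show ?thesis using p by (simp add: algebra_simps)
  qed
  have one: "(\<Sum>z\<in>?S. pmf p z) = 1" using fin by (intro sum_pmf_eq_1) auto
  have "- ln n + 1 - card ?S / n = (\<Sum>z\<in>?S. - pmf p z * ln n + pmf p z - 1/n)"
    using one by (simp add: sum.distrib sum_subtractf sum_negf flip: sum_distrib_right)
  also have "\<dots> \<le> (\<Sum>z\<in>?S. pmf p z * ln (pmf p z))" by (intro sum_mono pt)
  also have "\<dots> = - ent p" unfolding ent_def using fin by (simp add: expectation_pmf_sum[of ?S])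
  finally have "ent p \<le> ln n - 1 + card ?S / n" by linarith
  moreover have "card ?S / n \<le> 1" using cS n by (simp add: field_simps)
  ultimately show ?thesis by linarith
qed

lemma ent_map_inj: "inj f \<Longrightarrow> ent (map_pmf f p) = ent p"
  by (simp add: ent_def pmf_map_inj')

lemma expectation_mixture:
  fixes f :: "'a \<Rightarrow> real"
  assumes T: "finite T" "T \<noteq> {}" and fin: "\<And>t. t \<in> T \<Longrightarrow> finite (set_pmf (P t))"
  shows "measure_pmf.expectation (bind_pmf (pmf_of_set T) P) f
       = (\<Sum>t\<in>T. measure_pmf.expectation (P t) f) / card T"
proof -
  let ?A = "\<Union>t\<in>T. set_pmf (P t)"
  have A: "finite ?A" using T fin by auto
  have s: "set_pmf (bind_pmf (pmf_of_set T) P) = ?A" using T by (simp add: set_bind_pmf)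
  have "measure_pmf.expectation (bind_pmf (pmf_of_set T) P) f
      = (\<Sum>z\<in>?A. (\<Sum>t\<in>T. pmf (P t) z) / card T * f z)"
    using A s T by (subst expectation_pmf_sum[of ?A]) (auto simp: pmf_bind integral_pmf_of_set)
  also have "\<dots> = (\<Sum>z\<in>?A. \<Sum>t\<in>T. pmf (P t) z * f z) / card T"
    by (simp add: sum_divide_distrib sum_distrib_right)
  also have "\<dots> = (\<Sum>t\<in>T. \<Sum>z\<in>?A. pmf (P t) z * f z) / card T"
    by (subst sum.swap) simp
  also have "\<dots> = (\<Sum>t\<in>T. measure_pmf.expectation (P t) f) / card T"
    using A by (intro arg_cong2[of _ _ _ _ "(/)"] sum.cong refl expectation_pmf_sum[symmetric]) auto
  finally show ?thesis .
qed

text \<open>Divided by \<open>card T\<close>, both sides are the mutual information between a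
  uniform index \<open>t\<close> and a sample of \<open>P t\<close>. This turns a small entropy
  increment into small divergences.\<close>

lemma ent_mixture:
  assumes T: "finite T" "T \<noteq> {}" and fin: "\<And>t. t \<in> T \<Longrightarrow> finite (set_pmf (P t))"
  defines "q \<equiv> bind_pmf (pmf_of_set T) P"
  shows "(\<Sum>t\<in>T. kl (P t) q) = card T * ent q - (\<Sum>t\<in>T. ent (P t))"
proof -
  have i: "integrable (measure_pmf (P t)) g" if "t \<in> T" for g :: "'b \<Rightarrow> real" and t
    using fin that by (auto intro: integrable_measure_pmf_finite)
  have "(\<Sum>t\<in>T. kl (P t) q) = (\<Sum>t\<in>T. - ent (P t) - measure_pmf.expectation (P t) (\<lambda>z. ln (pmf q z)))"
    unfolding kl_def ent_def by (intro sum.cong refl) (simp add: i)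
  also have "\<dots> = - (\<Sum>t\<in>T. ent (P t)) - (\<Sum>t\<in>T. measure_pmf.expectation (P t) (\<lambda>z. ln (pmf q z)))"
    by (simp add: sum_subtractf sum_negf)
  also have "(\<Sum>t\<in>T. measure_pmf.expectation (P t) (\<lambda>z. ln (pmf q z))) = - card T * ent q"
    unfolding ent_def using expectation_mixture[where P = P and f = "\<lambda>z. ln (pmf q z)", OF T fin] T
    by (simp add: q_def)
  finally show ?thesis by simp
qed

section \<open>Random walks on a set of shifts and balanced queries\<close>

text \<open>A 0/1 variable of mean \<open>v\<close> has variance \<open>v (1 - v)\<close>, so this
  is the Efron-Stein inequality for two independent variables, \<open>z\<close> from
  \<open>p\<close> and \<open>t\<close> uniform on \<open>T\<close>: the conditional variances given
  \<open>z\<close> and given \<open>t\<close> bound the total one.\<close>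

lemma bernoulli_variance_mixture:
  fixes f :: "'a \<Rightarrow> 'b \<Rightarrow> real" and p :: "'a pmf"
  assumes T: "finite T" "T \<noteq> {}" and S: "finite (set_pmf p)"
    and f01: "\<And>z t. f z t = 0 \<or> f z t = 1"
  defines "a \<equiv> \<lambda>z. (\<Sum>t\<in>T. f z t) / card T"
    and "m \<equiv> \<lambda>t. measure_pmf.expectation p (\<lambda>z. f z t)"
  assumes a: "\<And>z. z \<in> set_pmf p \<Longrightarrow> a z * (1 - a z) \<le> \<delta>"
    and m: "\<And>t. t \<in> T \<Longrightarrow> m t * (1 - m t) \<le> \<epsilon>"
  defines "\<mu> \<equiv> (\<Sum>t\<in>T. m t) / card T"
  shows "\<mu> * (1 - \<mu>) \<le> \<epsilon> + \<delta>"
proof -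
  let ?S = "set_pmf p" and ?c = "real (card T)"
  have c: "?c > 0" using T by (simp add: card_gt_0_iff)
  have m_sum: "m t = (\<Sum>z\<in>?S. pmf p z * f z t)" for t
    unfolding m_def using S by (simp add: expectation_pmf_sum[of ?S])
  have one: "(\<Sum>z\<in>?S. pmf p z) = 1" using S by (intro sum_pmf_eq_1) auto
  have a_sum: "(\<Sum>t\<in>T. f z t) = ?c * a z" for z using c by (simp add: a_def)
  have a01: "0 \<le> a z" "a z \<le> 1" for z
  proof -
    have "0 \<le> f z t" "f z t \<le> 1" for t using f01[of z t] by auto
    then have "0 \<le> (\<Sum>t\<in>T. f z t)" "(\<Sum>t\<in>T. f z t) \<le> ?c"
      using sum_bounded_above[of T "f z" 1] by (auto intro: sum_nonneg)
    then show "0 \<le> a z" "a z \<le> 1" using c by (auto simp: a_def)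
  qed
  have m01: "0 \<le> m t" "m t \<le> 1" for t
  proof -
    have "0 \<le> f z t" "f z t \<le> 1" for z using f01[of z t] by auto
    then have "0 \<le> (\<Sum>z\<in>?S. pmf p z * f z t)" "(\<Sum>z\<in>?S. pmf p z * f z t) \<le> (\<Sum>z\<in>?S. pmf p z * 1)"
      by (intro sum_nonneg sum_mono mult_left_mono mult_nonneg_nonneg; simp)+
    then show "0 \<le> m t" "m t \<le> 1" using one by (auto simp: m_sum)
  qed
  have \<mu>1: "(\<Sum>t\<in>T. m t) = ?c * \<mu>" using c by (simp add: \<mu>_def)
  have \<mu>2: "(\<Sum>z\<in>?S. pmf p z * a z) = \<mu>"
  proof -
    have "?c * \<mu> = (\<Sum>t\<in>T. \<Sum>z\<in>?S. pmf p z * f z t)" by (simp flip: \<mu>1 add: m_sum)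
    also have "\<dots> = (\<Sum>z\<in>?S. pmf p z * (?c * a z))"
      by (subst sum.swap) (simp flip: sum_distrib_left a_sum)
    also have "\<dots> = ?c * (\<Sum>z\<in>?S. pmf p z * a z)"
      by (simp add: sum_distrib_left mult_ac)
    finally show ?thesis using c by simp
  qed
  \<comment> \<open>The indicator form of the hybrid step \<open>(z, t) \<rightarrow> (z, t') \<rightarrow> (z', t')\<close>, averaged over the two outer variables.\<close>
  have pt: "(a z + m t) * f z t \<le> f z t + a z * m t" for z t
  proof -
    have "0 \<le> (1 - a z) * (1 - m t)" "0 \<le> a z * m t" using a01[of z] m01[of t] by auto
    then show ?thesis using f01[of z t] by (auto simp: algebra_simps)
  qed
  have "(\<Sum>z\<in>?S. pmf p z * (\<Sum>t\<in>T. (a z + m t) * f z t))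
      \<le> (\<Sum>z\<in>?S. pmf p z * (\<Sum>t\<in>T. f z t + a z * m t))"
    by (intro sum_mono mult_left_mono pt) auto
  moreover have "(\<Sum>z\<in>?S. pmf p z * (\<Sum>t\<in>T. (a z + m t) * f z t))
      = ?c * (\<Sum>z\<in>?S. pmf p z * (a z)\<^sup>2) + (\<Sum>t\<in>T. (m t)\<^sup>2)"
  proof -
    have "(\<Sum>z\<in>?S. pmf p z * (\<Sum>t\<in>T. (a z + m t) * f z t))
       = (\<Sum>z\<in>?S. pmf p z * (a z * (\<Sum>t\<in>T. f z t))) + (\<Sum>z\<in>?S. \<Sum>t\<in>T. m t * (pmf p z * f z t))"
      by (simp add: sum_distrib_left sum.distrib algebra_simps)
    also have "(\<Sum>z\<in>?S. pmf p z * (a z * (\<Sum>t\<in>T. f z t))) = ?c * (\<Sum>z\<in>?S. pmf p z * (a z)\<^sup>2)"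
      by (simp add: a_sum power2_eq_square sum_distrib_left mult_ac)
    also have "(\<Sum>z\<in>?S. \<Sum>t\<in>T. m t * (pmf p z * f z t)) = (\<Sum>t\<in>T. (m t)\<^sup>2)"
      by (subst sum.swap) (simp add: power2_eq_square m_sum flip: sum_distrib_left)
    finally show ?thesis .
  qed
  moreover have "(\<Sum>z\<in>?S. pmf p z * (\<Sum>t\<in>T. f z t + a z * m t)) = ?c * \<mu> + ?c * \<mu>\<^sup>2"
  proof -
    have "(\<Sum>z\<in>?S. pmf p z * (\<Sum>t\<in>T. f z t + a z * m t))
      = (\<Sum>z\<in>?S. (?c + ?c * \<mu>) * (pmf p z * a z))"
      by (intro sum.cong refl) (simp add: sum.distrib a_sum \<mu>1 algebra_simps flip: sum_distrib_left)
    also have "\<dots> = (?c + ?c * \<mu>) * \<mu>" by (simp add: \<mu>2 flip: sum_distrib_left)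
    finally show ?thesis by (simp add: algebra_simps power2_eq_square)
  qed
  moreover have "?c * \<mu> - (\<Sum>t\<in>T. (m t)\<^sup>2) \<le> ?c * \<epsilon>"
  proof -
    have "(\<Sum>t\<in>T. m t * (1 - m t)) \<le> (\<Sum>t\<in>T. \<epsilon>)" by (intro sum_mono m)
    then show ?thesis by (simp add: algebra_simps power2_eq_square sum_subtractf \<mu>1)
  qed
  moreover have "?c * (\<mu> - (\<Sum>z\<in>?S. pmf p z * (a z)\<^sup>2)) \<le> ?c * \<delta>"
  proof -
    have "(\<Sum>z\<in>?S. pmf p z * (a z * (1 - a z))) \<le> (\<Sum>z\<in>?S. pmf p z * \<delta>)"
      by (intro sum_mono mult_left_mono a) auto
    then have "\<mu> - (\<Sum>z\<in>?S. pmf p z * (a z)\<^sup>2) \<le> \<delta>"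
      by (simp add: algebra_simps power2_eq_square sum_subtractf one flip: \<mu>2 sum_distrib_left)
    then show ?thesis using c by (intro mult_left_mono) auto
  qed
  \<comment> \<open>With E for averages, the pointwise bound gives E a^2 + E m^2 \<le> \<mu> +
    \<mu>^2, while the hypotheses give E a^2 \<ge> \<mu> - \<delta> and E m^2 \<ge> \<mu> -
    \<epsilon>.\<close>
  ultimately have "?c * (\<mu> * (1 - \<mu>)) \<le> ?c * (\<epsilon> + \<delta>)"
    by (simp add: algebra_simps power2_eq_square)
  then show ?thesis using c by simp
qed

text \<open>The law of \<open>X\<^sub>j\<close> from the overview. Drawing the new summand first
  makes \<open>walk T (Suc j)\<close> literally a uniform mixture of translates of
  \<open>walk T j\<close>.\<close>

primrec walk :: "nat set \<Rightarrow> nat \<Rightarrow> nat pmf" where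
  "walk T 0 = return_pmf 0"
| "walk T (Suc j) = bind_pmf (pmf_of_set T) (\<lambda>t. map_pmf ((+) t) (walk T j))"

lemma set_walk:
  assumes "T \<subseteq> {..<L}" "T \<noteq> {}"
  shows "set_pmf (walk T j) \<subseteq> {..j * L}"
proof (induction j)
  case (Suc j)
  have "finite T" using assms finite_subset by blast
  show ?case
  proof
    fix z assume "z \<in> set_pmf (walk T (Suc j))"
    then obtain t y where "t \<in> T" "y \<in> set_pmf (walk T j)" "z = t + y"
      using \<open>finite T\<close> assms by (auto simp: set_bind_pmf)
    moreover have "t < L" "y \<le> j * L" using calculation assms Suc by auto
    ultimately show "z \<in> {..Suc j * L}" by simp
  qed
qed simp

text \<open>Here \<open>k\<close> bounds the number of walk steps: it is large enough to force an
  entropy increment of at most 1/16, while an imbalance of \<open>1/(20 k)\<close> per step keeps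
  the variance at most 1/20. By \<open>(k + 1) * L \<le> n\<close>, a walk plus one shift fits into
  the initial zeros or the final ones.\<close>

lemma balanced_query_exists:
  fixes F :: "nat \<Rightarrow> bool"
  assumes T: "T \<subseteq> {..<L}" "card T \<ge> 2" and k: "16 * ln (real n) \<le> real k" "k > 0"
    and n: "(k + 1) * L \<le> n"
    and F0: "\<And>x. x \<le> n \<Longrightarrow> \<not> F x" and F1: "\<And>x. M < x \<Longrightarrow> x \<le> M + n \<Longrightarrow> F x"
  shows "\<exists>i. i + L \<le> M + n \<and> card T \<le> 20 * k * card {t\<in>T. F (t + i)} \<and>
             card T \<le> 20 * k * card {t\<in>T. \<not> F (t + i)}"
proof (rule ccontr)
  assume no: "\<not> ?thesis"
  let ?c = "real (card T)"
  have finT: "finite T" "T \<noteq> {}" and c2: "?c \<ge> 2" using T by (auto intro: finite_subset)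
  define f :: "nat \<Rightarrow> real" where "f = (\<lambda>x. of_bool (F x))"
  have f01: "f x = 0 \<or> f x = 1" for x by (simp add: f_def)
  have supp: "set_pmf (walk T j) \<subseteq> {..j * L}" for j by (rule set_walk[OF T(1) finT(2)])
  have finw: "finite (set_pmf (walk T j))" for j by (rule finite_subset[OF supp]) simp
  define m where "m = (\<lambda>j y. measure_pmf.expectation (walk T j) (\<lambda>z. f (y + z)))"
  have m_Suc: "m (Suc j) y = (\<Sum>t\<in>T. m j (y + t)) / ?c" for j y
    unfolding m_def walk.simps
    by (subst expectation_mixture) (auto simp: finT finw add.assoc)
  have unbal: "(\<Sum>t\<in>T. f (i + t)) / ?c * (1 - (\<Sum>t\<in>T. f (i + t)) / ?c) \<le> 1 / (20 * k)"
    if "i + L \<le> M + n" for i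
  proof -
    let ?a = "card {t\<in>T. F (t + i)}" and ?b = "card {t\<in>T. \<not> F (t + i)}"
    have "(\<Sum>t\<in>T. f (i + t)) = ?a"
      using finT by (simp add: f_def add.commute sum.If_cases of_bool_def Int_def)
    moreover have "card T = ?a + ?b"
      using finT by (subst card_Un_disjoint[symmetric]) (auto intro: arg_cong[of _ _ card])
    then have ab: "?c = real ?a + real ?b" by simp
    moreover have "real ?a / ?c * (real ?b / ?c) \<le> 1 / (20 * k)"
    proof -
      have le1: "real ?a / ?c \<le> 1" "real ?b / ?c \<le> 1" using ab c2 by (auto simp: field_simps)
      have "20 * k * ?a < card T \<or> 20 * k * ?b < card T" using no that by force
      then have "real (20 * k * ?a) < ?c \<or> real (20 * k * ?b) < ?c" by (simp only: of_nat_less_iff)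
      then have "real ?a / ?c \<le> 1 / (20 * k) \<or> real ?b / ?c \<le> 1 / (20 * k)"
        using c2 k by (auto simp: field_simps)
      then show ?thesis
      proof
        assume "real ?a / ?c \<le> 1 / (20 * k)"
        then have "real ?a / ?c * (real ?b / ?c) \<le> 1 / (20 * k) * 1"
          using le1 by (intro mult_mono) auto
        then show ?thesis by simp
      next
        assume "real ?b / ?c \<le> 1 / (20 * k)"
        then have "real ?a / ?c * (real ?b / ?c) \<le> 1 * (1 / (20 * k))"
          using le1 by (intro mult_mono) auto
        then show ?thesis by simp
      qed
    qed
    moreover have "1 - real ?a / ?c = real ?b / ?c" using ab c2 by (simp add: field_simps)
    ultimately show ?thesis by simp
  qed
  have var: "m j y * (1 - m j y) \<le> j / (20 * k)" if "y + j * L \<le> M + n" for j y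
    using that
  proof (induction j arbitrary: y)
    case 0
    then show ?case using f01[of y] by (auto simp: m_def)
  next
    case (Suc j)
    have *: "m (Suc j) y = (\<Sum>t\<in>T. measure_pmf.expectation (walk T j) (\<lambda>z. f (y + z + t))) / ?c"
      unfolding m_Suc by (simp add: m_def add_ac)
    \<comment> \<open>Efron-Stein with \<open>z\<close> the first \<open>j\<close> summands and
      \<open>t\<close> the new one: fixing \<open>z\<close> leaves a single query on
      \<open>T\<close>, fixing \<open>t\<close> leaves a \<open>j\<close>-step walk from
      \<open>y + t\<close>.\<close>
    have "m (Suc j) y * (1 - m (Suc j) y) \<le> j / (20 * k) + 1 / (20 * k)"
      unfolding *
    proof (rule bernoulli_variance_mixture[OF finT finw])
      fix z assume "z \<in> set_pmf (walk T j)"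
      then have "z \<le> j * L" using supp by blast
      then show "(\<Sum>t\<in>T. f (y + z + t)) / ?c * (1 - (\<Sum>t\<in>T. f (y + z + t)) / ?c) \<le> 1 / (20 * k)"
        using Suc.prems by (intro unbal) simp
    next
      fix t assume "t \<in> T"
      then have "t < L" using T by auto
      then have "m j (y + t) * (1 - m j (y + t)) \<le> j / (20 * k)"
        using Suc.prems by (intro Suc.IH) simp
      then show "measure_pmf.expectation (walk T j) (\<lambda>z. f (y + z + t)) *
          (1 - measure_pmf.expectation (walk T j) (\<lambda>z. f (y + z + t))) \<le> j / (20 * k)"
        by (simp add: m_def add_ac)
    qed (rule f01)
    then show ?case by (simp add: add_divide_distrib)
  qed
  \<comment> \<open>A mean strictly between 1/10 and 9/10 would have variance above 9/100, more than
    the 1/20 available.\<close>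
  have dich: "m j y \<le> 1/10 \<or> m j y \<ge> 9/10" if "y + j * L \<le> M + n" "j < k" for j y
  proof (rule ccontr)
    assume "\<not> ?thesis"
    then have "0 < (m j y - 1/10) * (9/10 - m j y)" by simp
    also have "\<dots> = m j y * (1 - m j y) - 9/100" by (simp add: field_simps)
    finally have "9/100 < m j y * (1 - m j y)" by simp
    moreover have "real j / (20 * k) \<le> 1/20" using that(2) by (simp add: field_simps)
    ultimately show False using var[OF that(1)] by linarith
  qed
  have "L > 0" using T finT by (cases L) auto
  \<comment> \<open>The \<open>k\<close> increments telescope to at most
    \<open>ln n \<le> k/16\<close>, so they cannot all exceed 1/16.\<close>
  obtain j where j: "j < k" "ent (walk T (Suc j)) - ent (walk T j) \<le> 1/16"
  proof (rule ccontr)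
    assume "\<not> thesis"
    then have "\<And>j. j < k \<Longrightarrow> 1/16 < ent (walk T (Suc j)) - ent (walk T j)" using that by force
    then have "(\<Sum>j<k. 1/16) < (\<Sum>j<k. ent (walk T (Suc j)) - ent (walk T j))"
      using k by (intro sum_strict_mono) auto
    also have "\<dots> = ent (walk T k) - ent (walk T 0)" by (rule sum_lessThan_telescope)
    also have "ent (walk T 0) = 0" by (simp add: ent_def)
    \<comment> \<open>The support has at most \<open>k * L + 1\<close> points, which is at most
      \<open>(k + 1) * L\<close> because \<open>L > 0\<close>.\<close>
    also have "ent (walk T k) \<le> ln (real n)"
      by (rule ent_le_ln_card[OF _ supp]) (use n \<open>L > 0\<close> in auto)
    finally show False using k by simp
  qed
  define q where "q = walk T (Suc j)"
  define P where "P = (\<lambda>t. map_pmf ((+) t) (walk T j))"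
  have q_eq: "q = bind_pmf (pmf_of_set T) P" by (simp add: q_def P_def)
  have finq: "finite (set_pmf q)" unfolding q_def by (rule finw)
  have Psub: "set_pmf (P t) \<subseteq> set_pmf q" if "t \<in> T" for t
    using that finT by (auto simp: q_eq set_bind_pmf)
  have "(\<Sum>t\<in>T. kl (P t) q) = ?c * ent q - (\<Sum>t\<in>T. ent (P t))"
    unfolding q_eq by (rule ent_mixture) (auto simp: finT P_def finw)
  also have "(\<Sum>t\<in>T. ent (P t)) = ?c * ent (walk T j)" by (simp add: P_def ent_map_inj)
  also have "?c * ent q - ?c * ent (walk T j) = ?c * (ent q - ent (walk T j))"
    by (simp add: right_diff_distrib)
  also have "\<dots> \<le> ?c * (1/16)" using j(2) unfolding q_def by (intro mult_left_mono) auto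
  finally have kl_sum: "(\<Sum>t\<in>T. kl (P t) q) \<le> ?c * (1/16)" .
  let ?G = "{t\<in>T. kl (P t) q < 1/5}"
  \<comment> \<open>With at most one index below 1/5 the sum would be at least (c - 1)/5 for c =
    \<open>card T\<close>, which exceeds c/16 since c \<ge> 2.\<close>
  have "card ?G \<ge> 2"
  proof (rule ccontr)
    assume "\<not> ?thesis"
    then have G: "real (card ?G) \<le> 1" by simp
    have "card T = card ?G + card (T - ?G)"
      using finT by (subst card_Un_disjoint[symmetric]) (auto intro: arg_cong[of _ _ card])
    then have "?c - 1 \<le> real (card (T - ?G))" using G by simp
    moreover have "real (card (T - ?G)) * (1/5) = (\<Sum>t\<in>T - ?G. 1/5)" by simp
    moreover have "\<dots> \<le> (\<Sum>t\<in>T - ?G. kl (P t) q)" by (intro sum_mono) auto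
    moreover have "\<dots> \<le> (\<Sum>t\<in>T. kl (P t) q)"
      using finT Psub finq by (intro sum_mono2 kl_nonneg) auto
    ultimately show False using kl_sum c2 by linarith
  qed
  then obtain t t' where tt: "t \<in> ?G" "t' \<in> ?G" "t < t'"
    by (metis (no_types, lifting) card_le_Suc0_iff_eq card.infinite linorder_neqE_nat
        not_less_eq_eq numeral_2_eq_2 zero_le)
  define d where "d = t' - t"
  have d: "d > 0" "t' = t + d" "t' < L" "t < L" using tt T by (auto simp: d_def)
  have jL: "(j + 1) * L \<le> n"
    using j(1) n mult_le_mono1[of "j + 1" "k + 1" L] by linarith
  have P_exp: "measure_pmf.expectation (P t) (\<lambda>z. f (y + z)) = m j (y + t)" for t y
    by (simp add: P_def m_def add_ac)
  \<comment> \<open>If the majority flipped between \<open>y + t\<close> and \<open>y + t'\<close>,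
    the mean under the mixture \<open>q\<close> would lie on the wrong side of 1/2 for one of the
    two laws, whose divergence from \<open>q\<close> would then be at least 1/5.\<close>
  have step: "m j (y + t + d) \<le> 1/10" if y: "y \<le> M" and m: "m j (y + t) \<le> 1/10" for y
  proof (rule ccontr)
    assume "\<not> ?thesis"
    then have m': "m j (y + t') \<ge> 9/10"
      using dich[of "y + t'" j] j(1) y d jL by (auto simp: add_ac)
    show False
    proof (cases "measure_pmf.expectation q (\<lambda>z. f (y + z)) \<ge> 1/2")
      case True
      have "kl (P t) q \<ge> 1/5"
        by (rule kl_ge_of_test[OF finq Psub _ _ True]) (use tt m f01 P_exp in auto)
      then show False using tt by simp
    next
      case False
      have "kl (P t') q \<ge> 1/5"
        by (rule kl_ge_of_test_compl[OF finq Psub, of _ "\<lambda>z. f (y + z)"]) (use tt m' f01 P_exp False in auto)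
      then show False using tt by simp
    qed
  qed
  have m_const: "m j y = v" if "\<And>z. z \<le> j * L \<Longrightarrow> f (y + z) = v" for y v
  proof -
    have "m j y = measure_pmf.expectation (walk T j) (\<lambda>_. v)"
      unfolding m_def
      by (intro integral_cong_AE) (use that supp[of j] in \<open>auto simp: AE_measure_pmf_iff\<close>)
    then show ?thesis by simp
  qed
  \<comment> \<open>Translating repeatedly by \<open>d\<close> preserves the majority 0. The first
    multiple of \<open>d\<close> beyond \<open>M\<close> puts the whole window among the ones, which
    is the contradiction.\<close>
  have "m j (l * d + t) \<le> 1/10" if "l * d \<le> M + d" for l
    using that
  proof (induction l)
    case 0
    have "m j t = 0" by (rule m_const) (use F0 d jL in \<open>auto simp: f_def\<close>)
    then show ?case by simp
  next
    case (Suc l)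
    then have "m j (l * d + t + d) \<le> 1/10" by (intro step) auto
    then show ?case by (simp add: add_ac)
  qed
  moreover define l where "l = M div d + 1"
  have l: "l * d \<le> M + d" "M < l * d"
    using d by (auto simp: l_def dividend_less_div_times)
  ultimately have "m j (l * d + t) \<le> 1/10" by blast
  moreover have "m j (l * d + t) = 1"
    by (rule m_const) (use F1 l d jL in \<open>auto simp: f_def\<close>)
  ultimately show False by simp
qed

section \<open>Query trees and the number of states\<close>

text \<open>Bounds the growth of the exponential moment per tree level: a prediction
  \<open>x\<close> gains \<open>x\<close> on one child and \<open>1 - x\<close> on the other, each
  of weight 1/2, hence a factor of at most 2.\<close>

lemma exp_interval_sum_le:
  fixes x :: real
  assumes "0 \<le> x" "x \<le> 1"
  shows "exp x + exp (1 - x) \<le> 4"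
proof -
  have "0 \<le> (exp x - 1) * (exp (1 - x) - 1)" using assms by simp
  also have "\<dots> = exp 1 - exp x - exp (1 - x) + 1"
    by (simp add: algebra_simps flip: exp_add)
  finally show ?thesis using exp_le by simp
qed

text \<open>
  \<open>Y t m\<close> is the number of answers on the branch to \<open>t\<close> that the state \<open>m\<close> predicts correctly, in
  expectation over its coins; \<open>w\<close> is the leaf distribution of a fair random descent.
\<close>

lemma littlestone_weights:
  fixes P h :: "nat \<Rightarrow> 'm \<Rightarrow> real" and F :: "nat \<Rightarrow> bool"
  assumes S: "\<And>t. t < L \<Longrightarrow> (\<Sum>m\<in>S. P t m) = 1"
    and h: "\<And>i m. 0 \<le> h i m" "\<And>i m. h i m \<le> 1"
    and P1: "\<And>t i. t < L \<Longrightarrow> i \<in> I \<Longrightarrow> F (t + i) \<Longrightarrow> (\<Sum>m\<in>S. P t m * h i m) \<ge> 9/10"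
    and P0: "\<And>t i. t < L \<Longrightarrow> i \<in> I \<Longrightarrow> \<not> F (t + i) \<Longrightarrow> (\<Sum>m\<in>S. P t m * h i m) \<le> 1/10"
    and b: "b \<ge> 2"
    and split: "\<And>T. T \<subseteq> {..<L} \<Longrightarrow> card T \<ge> 2 \<Longrightarrow>
      \<exists>i\<in>I. card T \<le> b * card {t\<in>T. F (t + i)} \<and> card T \<le> b * card {t\<in>T. \<not> F (t + i)}"
    and T: "T \<subseteq> {..<L}" "b ^ D \<le> card T"
  shows "\<exists>w Y. (\<forall>t\<in>T. 0 \<le> w t) \<and> (\<Sum>t\<in>T. w t) = 1 \<and>
     (\<forall>t\<in>T. (\<Sum>m\<in>S. P t m * Y t m) \<ge> 9/10 * real D) \<and>
     (\<forall>m. (\<Sum>t\<in>T. w t * exp (Y t m)) \<le> 2 ^ D)"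
  using T
proof (induction D arbitrary: T)
  case 0
  then have "finite T" "card T \<ge> 1" by (auto intro: finite_subset)
  then obtain t where t: "t \<in> T" by fastforce
  show ?case
    by (rule exI[of _ "\<lambda>x. of_bool (x = t)"], rule exI[of _ "\<lambda>_ _. 0"])
      (use t \<open>finite T\<close> in \<open>auto simp: of_bool_def\<close>)
next
  case (Suc D)
  have fin: "finite T" using Suc.prems by (auto intro: finite_subset)
  have "2 \<le> b ^ Suc D" using b by (metis one_le_numeral order.trans power_Suc mult_le_mono one_le_power mult.right_neutral)
  then have "card T \<ge> 2" using Suc.prems by linarith
  then obtain i where i: "i \<in> I" "card T \<le> b * card {t\<in>T. F (t + i)}" "card T \<le> b * card {t\<in>T. \<not> F (t + i)}"
    using split Suc.prems by blast
  define T1 where "T1 = {t\<in>T. F (t + i)}"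
  define T0 where "T0 = {t\<in>T. \<not> F (t + i)}"
  have "b * b ^ D \<le> card T" using Suc.prems by simp
  from order_trans[OF this i(2)] order_trans[OF this i(3)]
  have "b * b ^ D \<le> b * card T1" "b * b ^ D \<le> b * card T0" by (simp_all only: T1_def T0_def)
  then have c: "b ^ D \<le> card T1" "b ^ D \<le> card T0" using b by auto
  have sub: "T1 \<subseteq> {..<L}" "T0 \<subseteq> {..<L}" using Suc.prems by (auto simp: T1_def T0_def)
  obtain w1 Y1 where 1: "\<forall>t\<in>T1. 0 \<le> w1 t" "(\<Sum>t\<in>T1. w1 t) = 1"
     "\<forall>t\<in>T1. (\<Sum>m\<in>S. P t m * Y1 t m) \<ge> 9/10 * real D"
     "\<forall>m. (\<Sum>t\<in>T1. w1 t * exp (Y1 t m)) \<le> 2 ^ D"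
    using Suc.IH[OF sub(1) c(1)] by blast
  obtain w0 Y0 where 0: "\<forall>t\<in>T0. 0 \<le> w0 t" "(\<Sum>t\<in>T0. w0 t) = 1"
     "\<forall>t\<in>T0. (\<Sum>m\<in>S. P t m * Y0 t m) \<ge> 9/10 * real D"
     "\<forall>m. (\<Sum>t\<in>T0. w0 t * exp (Y0 t m)) \<le> 2 ^ D"
    using Suc.IH[OF sub(2) c(2)] by blast
  define w where "w = (\<lambda>t. (if F (t + i) then w1 t else w0 t) / 2)"
  define Y where "Y = (\<lambda>t m. if F (t + i) then Y1 t m + h i m else Y0 t m + (1 - h i m))"
  have decomp: "(\<Sum>t\<in>T. g t) = (\<Sum>t\<in>T1. g t) + (\<Sum>t\<in>T0. g t)" for g :: "nat \<Rightarrow> real"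
    using fin by (subst sum.union_disjoint[symmetric]) (auto simp: T1_def T0_def intro: sum.cong)
  have F1: "F (t + i)" if "t \<in> T1" for t using that by (simp add: T1_def)
  have F0: "\<not> F (t + i)" if "t \<in> T0" for t using that by (simp add: T0_def)
  have "\<forall>t\<in>T. 0 \<le> w t" using 1 0 by (auto simp: w_def T1_def T0_def)
  moreover have "(\<Sum>t\<in>T. w t) = 1"
    unfolding decomp using 1 0 F1 F0 by (simp add: w_def flip: sum_divide_distrib)
  moreover have "(\<Sum>m\<in>S. P t m * Y t m) \<ge> 9/10 * real (Suc D)" if "t \<in> T" for t
  proof -
    have tL: "t < L" using that Suc.prems by auto
    show ?thesis
    proof (cases "F (t + i)")
      case True
      then have "(\<Sum>m\<in>S. P t m * Y1 t m) \<ge> 9/10 * real D" using 1 that by (simp add: T1_def)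
      moreover have "(\<Sum>m\<in>S. P t m * h i m) \<ge> 9/10" using P1 tL i True by blast
      ultimately show ?thesis using True by (simp add: Y_def distrib_left sum.distrib)
    next
      case False
      then have "(\<Sum>m\<in>S. P t m * Y0 t m) \<ge> 9/10 * real D" using 0 that by (simp add: T0_def)
      moreover have "(\<Sum>m\<in>S. P t m * h i m) \<le> 1/10" using P0 tL i False by blast
      ultimately show ?thesis using False S[OF tL]
        by (simp add: Y_def distrib_left right_diff_distrib sum.distrib sum_subtractf)
    qed
  qed
  moreover have "(\<Sum>t\<in>T. w t * exp (Y t m)) \<le> 2 ^ Suc D" for m
  proof -
    have "(\<Sum>t\<in>T1. w t * exp (Y t m)) = exp (h i m) / 2 * (\<Sum>t\<in>T1. w1 t * exp (Y1 t m))"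
      unfolding sum_distrib_left by (intro sum.cong refl) (simp add: w_def Y_def F1 exp_add)
    also have "\<dots> \<le> exp (h i m) / 2 * 2 ^ D" using 1 by (intro mult_left_mono) auto
    finally have a: "(\<Sum>t\<in>T1. w t * exp (Y t m)) \<le> exp (h i m) / 2 * 2 ^ D" .
    have "(\<Sum>t\<in>T0. w t * exp (Y t m)) = exp (1 - h i m) / 2 * (\<Sum>t\<in>T0. w0 t * exp (Y0 t m))"
      unfolding sum_distrib_left
      by (intro sum.cong refl) (simp add: w_def Y_def F0 exp_add[of _ "1 - h i m"])
    also have "\<dots> \<le> exp (1 - h i m) / 2 * 2 ^ D" using 0 by (intro mult_left_mono) auto
    finally have "(\<Sum>t\<in>T. w t * exp (Y t m)) \<le> (exp (h i m) + exp (1 - h i m)) / 2 * 2 ^ D"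
      unfolding decomp using a by (simp add: algebra_simps add_divide_distrib)
    also have "\<dots> \<le> 4 / 2 * 2 ^ D"
      using exp_interval_sum_le[OF h[of i m]] by (intro mult_right_mono divide_right_mono) auto
    finally show ?thesis by simp
  qed
  ultimately show ?case by blast
qed

text \<open>The \<open>w\<close>-average of the mean of \<open>exp (Y t m)\<close> under
  \<open>P t\<close> is estimated twice: from below by Jensen, from above by replacing
  \<open>P t m\<close> with 1 and summing over \<open>t\<close> first. The result has content
  because exp (9/10) > 2.\<close>

lemma states_lower_bound:
  fixes P h :: "nat \<Rightarrow> 'm \<Rightarrow> real" and F :: "nat \<Rightarrow> bool"
  assumes S: "\<And>t. t < L \<Longrightarrow> (\<Sum>m\<in>S. P t m) = 1"
    and P: "\<And>t m. 0 \<le> P t m" "\<And>t m. P t m \<le> 1"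
    and h: "\<And>i m. 0 \<le> h i m" "\<And>i m. h i m \<le> 1"
    and P1: "\<And>t i. t < L \<Longrightarrow> i \<in> I \<Longrightarrow> F (t + i) \<Longrightarrow> (\<Sum>m\<in>S. P t m * h i m) \<ge> 9/10"
    and P0: "\<And>t i. t < L \<Longrightarrow> i \<in> I \<Longrightarrow> \<not> F (t + i) \<Longrightarrow> (\<Sum>m\<in>S. P t m * h i m) \<le> 1/10"
    and b: "b \<ge> 2"
    and split: "\<And>T. T \<subseteq> {..<L} \<Longrightarrow> card T \<ge> 2 \<Longrightarrow>
      \<exists>i\<in>I. card T \<le> b * card {t\<in>T. F (t + i)} \<and> card T \<le> b * card {t\<in>T. \<not> F (t + i)}"
    and L: "b ^ D \<le> L"
  shows "exp (9/10 * real D) \<le> real (card S) * 2 ^ D"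
proof -
  have c: "b ^ D \<le> card {..<L}" using L by simp
  obtain w Y where wY: "\<forall>t\<in>{..<L}. 0 \<le> w t" "(\<Sum>t<L. w t) = 1"
     "\<forall>t\<in>{..<L}. (\<Sum>m\<in>S. P t m * Y t m) \<ge> 9/10 * real D"
     "\<forall>m. (\<Sum>t<L. w t * exp (Y t m)) \<le> 2 ^ D"
    using littlestone_weights[where P = P and h = h and F = F and I = I, OF S h P1 P0 b split subset_refl c]
    by blast
  let ?a = "9/10 * real D"
  \<comment> \<open>Jensen's inequality via the tangent line of \<open>exp\<close> at
    \<open>?a\<close>.\<close>
  have jensen: "exp ?a \<le> (\<Sum>m\<in>S. P t m * exp (Y t m))" if "t < L" for t
  proof -
    have "exp ?a \<le> exp ?a * (1 - ?a + (\<Sum>m\<in>S. P t m * Y t m))"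
      using wY that by simp
    also have "\<dots> = (\<Sum>m\<in>S. P t m * (exp ?a * (1 + (Y t m - ?a))))"
    proof -
      have "(\<Sum>m\<in>S. P t m * (e * (1 + (Y t m - a)))) = e * ((1 - a) * (\<Sum>m\<in>S. P t m) + (\<Sum>m\<in>S. P t m * Y t m))"
        for e a by (simp add: sum_distrib_left sum.distrib[symmetric] algebra_simps)
      then show ?thesis using S[OF that] by simp
    qed
    also have "\<dots> \<le> (\<Sum>m\<in>S. P t m * exp (Y t m))"
    proof (intro sum_mono mult_left_mono P)
      fix m
      have "exp ?a * (1 + (Y t m - ?a)) \<le> exp ?a * exp (Y t m - ?a)"
        by (intro mult_left_mono exp_ge_add_one_self) auto
      then show "exp ?a * (1 + (Y t m - ?a)) \<le> exp (Y t m)" by (simp flip: exp_add)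
    qed
    finally show ?thesis .
  qed
  have "exp ?a = (\<Sum>t<L. w t * exp ?a)" by (simp add: wY(2) flip: sum_distrib_right)
  also have "\<dots> \<le> (\<Sum>t<L. w t * (\<Sum>m\<in>S. 1 * exp (Y t m)))"
  proof (intro sum_mono mult_left_mono)
    fix t assume t: "t \<in> {..<L}"
    then have "exp ?a \<le> (\<Sum>m\<in>S. P t m * exp (Y t m))" using jensen by simp
    also have "\<dots> \<le> (\<Sum>m\<in>S. 1 * exp (Y t m))"
      by (intro sum_mono mult_right_mono P) auto
    finally show "exp ?a \<le> (\<Sum>m\<in>S. 1 * exp (Y t m))" .
  qed (use wY in auto)
  also have "\<dots> = (\<Sum>m\<in>S. \<Sum>t<L. w t * exp (Y t m))"
    by (subst sum.swap) (simp add: sum_distrib_left)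
  also have "\<dots> \<le> (\<Sum>m\<in>S. 2 ^ D)" using wY by (intro sum_mono) auto
  finally show ?thesis by simp
qed

section \<open>Streaming algorithms as predictors\<close>

text \<open>The Markov property: the continuation sees the past only through the memory, so one
  predictor serves all prefixes.\<close>

lemma memory_after_append:
  "memory_after A (\<sigma> @ \<tau>) =
     bind_pmf (memory_after A \<sigma>) (\<lambda>m. fold (\<lambda>x p. bind_pmf p (process A x)) \<tau> (return_pmf m))"
  by (induction \<tau> rule: rev_induct) (simp_all add: memory_after_def bind_return_pmf' bind_assoc_pmf)

lemma card_bool_lists_length_le:
  "finite {m :: bool list. length m \<le> s}" "card {m :: bool list. length m \<le> s} \<le> 2 ^ (s + 1)"
proof -
  have eq: "{m :: bool list. length m \<le> s} = {m. set m \<subseteq> UNIV \<and> length m \<le> s}" by simp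
  show "finite {m :: bool list. length m \<le> s}"
    unfolding eq by (intro finite_lists_length_le) simp
  have "card {m :: bool list. length m \<le> s} = (\<Sum>i\<le>s. 2 ^ i)"
    unfolding eq by (subst card_lists_length_le) auto
  also have "\<dots> = 2 ^ (s + 1) - 1" using sum_power2[of "s + 1"] by (simp add: lessThan_Suc_atMost atLeast0LessThan)
  finally show "card {m :: bool list. length m \<le> s} \<le> 2 ^ (s + 1)" by simp
qed

text \<open>The base is \<open>20 k\<close> for \<open>k = 16 \<lceil>ln n\<rceil>\<close>. The
  bound \<open>s \<ge> 1\<close> later absorbs additive constants.\<close>

lemma counter_space_bounds:
  fixes A :: "('a, bool) streaming_alg"
  assumes U: "U \<noteq> {}" and c: "c > 1" and n: "n > 1"
    and solves: "solves_approx_count U c n A"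
    and pd: "pseudo_deterministic (count_streams U c n) A"
    and space: "uses_space (count_streams U c n) A s"
  shows "s \<ge> 1"
    and "(320 * nat \<lceil>ln (real n)\<rceil>) ^ (D + 1) \<le> n \<Longrightarrow> real D / 5 \<le> real s + 1"
proof -
  obtain u where u: "u \<in> U" using U by blast
  \<comment> \<open>The greatest length not exceeding \<open>c n\<close>: the answer is forced to be
    true from \<open>M + 1\<close> on, and lengths up to \<open>M + n\<close> are
    admissible.\<close>
  define M where "M = nat \<lfloor>c * real n\<rfloor>"
  have M: "real M \<le> c * real n" "c * real n < real M + 1"
    using c n by (auto simp: M_def of_nat_nat)
  have str: "replicate x u \<in> count_streams U c n" if "x \<le> M + n" for x
  proof -
    have "real x \<le> real M + real n" using that by linarith
    then show ?thesis using M u by (auto simp: count_streams_def algebra_simps)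
  qed
  define g where "g = (\<lambda>x. pmf (run_alg A (replicate x u)) True)"
  \<comment> \<open>By pseudo-determinism, thresholding at 1/2 recovers the canonical function on
    constant streams, with a gap from 1/10 to 9/10 even at lengths outside the promise.\<close>
  define F where "F = (\<lambda>x. g x \<ge> 1/2)"
  have false_eq: "pmf p False = 1 - pmf p True" for p
    using sum_pmf_eq_1[OF finite_class.finite_UNIV subset_UNIV, of p] by (simp add: UNIV_bool)
  have g: "(F x \<longrightarrow> g x \<ge> 9/10) \<and> (\<not> F x \<longrightarrow> g x \<le> 1/10)" if x: "x \<le> M + n" for x
  proof -
    obtain G where "pmf (run_alg A (replicate x u)) G \<ge> 9/10"
      using pd str[OF x] unfolding pseudo_deterministic_def canonical_function_def by blast
    then show ?thesis by (cases G) (auto simp: F_def g_def false_eq)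
  qed
  have F0: "\<not> F x" if "x \<le> n" for x
    using solves str[of x] that unfolding solves_approx_count_def
    by (force simp: F_def g_def false_eq)
  have F1: "F x" if "M < x" "x \<le> M + n" for x
  proof -
    have "real x > c * real n" using that M by linarith
    then show ?thesis
      using solves str[OF that(2)] unfolding solves_approx_count_def by (force simp: F_def g_def)
  qed
  define P where "P = (\<lambda>t. memory_after A (replicate t u))"
  define R where "R = (\<lambda>i m. bind_pmf (fold (\<lambda>x p. bind_pmf p (process A x)) (replicate i u) (return_pmf m)) (answer A))"
  define h where "h = (\<lambda>i m. pmf (R i m) True)"
  have run: "run_alg A (replicate (t + i) u) = bind_pmf (P t) (R i)" for t i
    by (simp only: run_alg_def replicate_add memory_after_append bind_assoc_pmf P_def R_def)
  define S where "S = {m :: bool list. length m \<le> s}"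
  have finS: "finite S" and cardS: "card S \<le> 2 ^ (s + 1)"
    unfolding S_def by (rule card_bool_lists_length_le)+
  have PS: "set_pmf (P t) \<subseteq> S" if "t \<le> M + n" for t
    using space str[OF that] by (auto simp: uses_space_def P_def S_def)
  have gsum: "g (t + i) = (\<Sum>m\<in>S. pmf (P t) m * h i m)" if "t \<le> M + n" for t i
    using expectation_pmf_sum[OF finS PS[OF that], of "h i"]
    by (simp add: g_def run pmf_bind h_def)
  have sum1: "(\<Sum>m\<in>S. pmf (P t) m) = 1" if "t \<le> M + n" for t
    using finS PS[OF that] by (rule sum_pmf_eq_1)
  show "s \<ge> 1"
  proof (rule ccontr)
    assume "\<not> ?thesis"
    then have "s = 0" by simp
    then have "S = {[]}" by (auto simp: S_def)
    then have "g t = h 0 []" if "t \<le> M + n" for t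
      using gsum[OF that, of 0] sum1[OF that] by simp
    then have "g 0 = g (M + 1)" using n by simp
    then show False using F0[of 0] F1[of "M + 1"] n by (simp add: F_def)
  qed
  assume D: "(320 * nat \<lceil>ln (real n)\<rceil>) ^ (D + 1) \<le> n"
  define k where "k = 16 * nat \<lceil>ln (real n)\<rceil>"
  \<comment> \<open>Of the \<open>D + 1\<close> factors \<open>20 k\<close>, \<open>D\<close> give
    enough shifts for a tree of depth \<open>D\<close>; the last one pays for the factor
    \<open>k + 1\<close>.\<close>
  define L where "L = (20 * k) ^ D"
  have "ln (real n) > 0" using n by simp
  then have k: "16 * ln (real n) \<le> real k" "k > 0"
    by (simp_all add: k_def of_nat_nat)
  have "(k + 1) * L \<le> (20 * k) * L" using k by (intro mult_right_mono) auto
  also have "\<dots> \<le> n" using D by (simp add: L_def k_def)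
  finally have kL: "(k + 1) * L \<le> n" .
  then have "L \<le> n" by simp
  have "exp (9/10 * real D) \<le> real (card S) * 2 ^ D"
  proof (rule states_lower_bound[where P = "\<lambda>t. pmf (P t)" and h = h and F = F and
        b = "20 * k" and L = L and I = "{i. i + L \<le> M + n}"])
    fix T assume "T \<subseteq> {..<L}" "2 \<le> card T"
    from balanced_query_exists[where F = F, OF this k kL F0 F1]
    show "\<exists>i\<in>{i. i + L \<le> M + n}. card T \<le> 20 * k * card {t \<in> T. F (t + i)} \<and>
        card T \<le> 20 * k * card {t \<in> T. \<not> F (t + i)}" by simp
  next
    fix t i assume "t < L" "i \<in> {i. i + L \<le> M + n}" "F (t + i)"
    then show "9/10 \<le> (\<Sum>m\<in>S. pmf (P t) m * h i m)"
      using g[of "t + i"] gsum[of t i] by auto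
  next
    fix t i assume "t < L" "i \<in> {i. i + L \<le> M + n}" "\<not> F (t + i)"
    then show "(\<Sum>m\<in>S. pmf (P t) m * h i m) \<le> 1/10"
      using g[of "t + i"] gsum[of t i] by auto
  qed (use sum1 \<open>L \<le> n\<close> k in \<open>auto simp: h_def pmf_le_1 L_def\<close>)
  also have "\<dots> \<le> 2 ^ (s + 1) * 2 ^ D"
    using cardS by (intro mult_right_mono) (simp_all add: numeral_power_le_of_nat_cancel_iff of_nat_le_numeral_power_cancel_iff del: power_Suc)
  also have "\<dots> = 2 ^ (s + 1 + D)" by (simp only: power_add)
  finally have "ln (exp (9/10 * real D)) \<le> ln (2 ^ (s + 1 + D))"
    by (subst ln_le_cancel_iff) auto
  then have "9/10 * real D \<le> real (s + 1 + D) * ln 2"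
    by (subst (asm) ln_realpow) auto
  also have "\<dots> = (real s + 1) * ln 2 + real D * ln 2" by (simp add: algebra_simps)
  \<comment> \<open>Since ln 2 \<le> 25/36 < 7/10, a surplus of 9/10 - 7/10 = 1/5 per level
    remains.\<close>
  also have "\<dots> \<le> (real s + 1) * 1 + real D * (7/10)"
    using ln2_le_25_over_36 by (intro add_mono mult_left_mono) auto
  finally show "real D / 5 \<le> real s + 1" by simp
qed

section \<open>Asymptotics in n\<close>

text \<open>The best \<open>D\<close> is about \<open>r = ln n / ln b\<close>. Then
  \<open>r \<le> 12 s\<close>, \<open>sqrt (ln n) \<le> 12 r\<close> and a left side of at most
  \<open>2 sqrt (ln n)\<close> give 288 = 2 * 12 * 12.\<close>

lemma sqrt_loglog_le:
  fixes s n :: nat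
  assumes n: "n > 1" and s: "s \<ge> 1"
    and D: "\<And>D. (320 * nat \<lceil>ln (real n)\<rceil>) ^ (D + 1) \<le> n \<Longrightarrow> real D / 5 \<le> real s + 1"
  shows "sqrt (log 2 (real n) / log 2 (log 2 (real n))) \<le> 288 * real s"
proof (cases "n = 2")
  case True
  \<comment> \<open>At \<open>n = 2\<close> the iterated logarithm is 0, and division by 0 yields
    0.\<close>
  then show ?thesis by simp
next
  case False
  then have n3: "n \<ge> 3" using n by simp
  define x where "x = ln (real n)"
  define b where "b = 320 * nat \<lceil>x\<rceil>"
  define r where "r = x / ln b"
  have "exp (1::real) \<le> n" using exp_le n3 by linarith
  then have x1: "x \<ge> 1" unfolding x_def using n by (simp add: ln_ge_iff)
  have bx: "real b = 320 * of_int \<lceil>x\<rceil>" using x1 by (simp add: b_def of_nat_nat)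
  have b1: "real b \<ge> 320" using x1 bx by linarith
  have bu: "real b \<le> 640 * x" using x1 bx by linarith
  have lnb: "ln b > 0" using b1 by simp
  \<comment> \<open>A bound on \<open>ln b\<close> by a multiple of \<open>sqrt x\<close> suffices
    for the square root in the claim.\<close>
  have "ln b \<le> ln (640 * x)" using bu b1 by simp
  also have "\<dots> = ln 640 + ln x" using x1 by (simp add: ln_mult)
  also have "ln (640::real) \<le> ln (2 ^ 10)" by (subst ln_le_cancel_iff) auto
  also have "ln ((2::real) ^ 10) = 10 * ln 2" by (subst ln_realpow) auto
  also have "\<dots> \<le> 10" using ln_2_less_1 by simp
  also have "ln x = 2 * ln (sqrt x)" using x1 by (simp add: ln_sqrt)
  also have "ln (sqrt x) \<le> sqrt x" using x1 ln_le_minus_one[of "sqrt x"] by simp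
  finally have "ln b \<le> 10 + 2 * sqrt x" by simp
  also have "\<dots> \<le> 12 * sqrt x" using x1 by simp
  finally have "sqrt x * ln b \<le> sqrt x * (12 * sqrt x)" using x1 by (intro mult_left_mono) auto
  also have "\<dots> = 12 * x" using x1 by simp
  finally have r: "sqrt x \<le> 12 * r" using lnb by (simp add: r_def field_simps)
  have rs: "r \<le> 12 * real s"
  proof (cases "r < 1")
    case True
    then show ?thesis using s by simp
  next
    case False
    \<comment> \<open>The largest \<open>D\<close> with \<open>D + 1 \<le> r\<close>, so that
      \<open>b ^ (D + 1) \<le> n\<close>. Then r < D + 2 \<le> 5 s + 7 \<le> 12 s.\<close>
    define D where "D = nat \<lfloor>r\<rfloor> - 1"
    have Dr: "real (D + 1) \<le> r" "r < real D + 2"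
    proof -
      have "1 \<le> \<lfloor>r\<rfloor>" using False by simp
      then have "real (D + 1) = of_int \<lfloor>r\<rfloor>" by (simp add: D_def of_nat_diff)
      then show "real (D + 1) \<le> r" "r < real D + 2" by linarith+
    qed
    have "ln (real b ^ (D + 1)) = real (D + 1) * ln b" using b1 by (simp only: ln_realpow)
    also have "\<dots> \<le> r * ln b" using Dr lnb by (intro mult_right_mono) auto
    also have "\<dots> = ln n" using lnb by (simp add: r_def x_def)
    finally have "real b ^ (D + 1) \<le> real n" using b1 n by (subst (asm) ln_le_cancel_iff) auto
    then have "b ^ (D + 1) \<le> n" by (metis of_nat_le_iff of_nat_power)
    then have "real D / 5 \<le> real s + 1" using D by (simp only: b_def x_def)
    then show ?thesis using Dr s by simp
  qed
  have l1: "log 2 (real n) \<le> 2 * x"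
  proof -
    have "x * 1 \<le> x * (2 * ln 2)" using ln2_ge_two_thirds x1 by (intro mult_left_mono) auto
    then show ?thesis by (simp add: log_def x_def field_simps)
  qed
  \<comment> \<open>The inequalities 8 \<le> 9 and 2 \<le> 9/4 keep the iterated logarithm at least
    1/2 for \<open>n \<ge> 3\<close>.\<close>
  have "log 2 (3::real) \<ge> 3/2"
  proof -
    have "log 2 ((2::real) ^ 3) \<le> log 2 (3 ^ 2)" by (subst log_le_cancel_iff) auto
    then show ?thesis by (simp add: log_nat_power del: power_numeral)
  qed
  also have "log 2 3 \<le> log 2 (real n)" using n3 by simp
  finally have l2: "log 2 (real n) \<ge> 3/2" .
  have "log 2 (3/2::real) \<ge> 1/2"
  proof -
    have "log 2 ((2::real) ^ 1) \<le> log 2 ((3/2) ^ 2)" by (subst log_le_cancel_iff) (auto simp: power2_eq_square)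
    then have "log 2 ((2::real) ^ 1) \<le> 2 * log 2 (3/2)" by (subst (asm) (2) log_nat_power) auto
    then show ?thesis by simp
  qed
  also have "log 2 (3/2) \<le> log 2 (log 2 (real n))" using l2 by simp
  finally have l3: "log 2 (log 2 (real n)) \<ge> 1/2" .
  have "log 2 (real n) / log 2 (log 2 (real n)) \<le> 2 * x / (1/2)"
    using l1 l2 l3 x1 by (intro frac_le) auto
  then have "sqrt (log 2 (real n) / log 2 (log 2 (real n))) \<le> sqrt (2\<^sup>2 * x)"
    by (intro real_sqrt_le_mono) simp
  also have "\<dots> = 2 * sqrt x" by (simp add: real_sqrt_mult)
  finally show ?thesis using r rs by linarith
qed

theorem theorem1p3:
  "\<exists>(K::real) (d::nat). K > 0 \<and>
     (\<forall>(U::'a set) (c::real) (n::nat) (A::('a, bool) streaming_alg) (s::nat).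
        U \<noteq> {} \<longrightarrow> c > 1 \<longrightarrow> n > 1 \<longrightarrow>
        solves_approx_count U c n A \<longrightarrow>
        pseudo_deterministic (count_streams U c n) A \<longrightarrow>
        uses_space (count_streams U c n) A s \<longrightarrow>
        real s \<ge> K / c ^ d * sqrt (log 2 (real n) / log 2 (log 2 (real n))))"
proof (intro exI[of _ "1/288"] exI[of _ 0] conjI allI impI)
  fix U :: "'a set" and c :: real and n :: nat and A :: "('a, bool) streaming_alg" and s :: nat
  assume *: "U \<noteq> {}" "c > 1" "n > 1" "solves_approx_count U c n A"
    "pseudo_deterministic (count_streams U c n) A" "uses_space (count_streams U c n) A s"
  \<comment> \<open>The constant is uniform in \<open>c\<close>, so the exponent 0 works.\<close>
  show "real s \<ge> (1/288) / c ^ 0 * sqrt (log 2 (real n) / log 2 (log 2 (real n)))"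
    using sqrt_loglog_le[OF *(3) counter_space_bounds[OF *]] by simp
qed simp

end
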